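(* A locally finite graph $G$ is constructible if and only if $G$ admits a time dependent protective strategy for the cop.
   Context: Graphs are undirected and reflexive (there is a loop at every vertex); locally finite means that every vertex has only finitely many neighbours. Constructible: a vertex $\mu\neq\nu$ dominates $\nu$ in a graph if $\mu$ is adjacent to $\nu$ and to all neighbours of $\nu$. For a well order $<$ on the vertex set $V$ of $G$, $G_{\le\nu}$ denotes the subgraph of $G$ induced by $\{\gamma\in V:\gamma\le\nu\}$. $G$ is constructible if there is a well order $<$ on $V$ such that each vertex $\nu$ other than the least one is dominated in $G_{\le \nu}$ by some vertex of $G_{\le\nu}$. The game: two players, the cop and the robber, have perfect information and move in rounds $0,1,2,\dots$; the cop plays in even rounds, the robber in odd rounds. In round $0$ the cop chooses a starting vertex, in round $1$ the robber chooses a starting vertex; in each later round the player whose turn it is moves to a neighbour of their current vertex (because of the loops, staying put is allowed). The robber is caught (and the game ends) as soon as both players occupy the same vertex. A time dependent strategy of the cop is a choice of starting vertex together with a map $s\colon V\times V\times\mathbb N\to V$ assigning to $(c,r,t)$ a neighbour of $c$: when it is the cop's turn, the cop is at $c$, the robber is at $r$, and $t$ is the number of the current round, she moves to $s(c,r,t)$. (The values of $s$ on configurations that cannot occur are irrelevant.) Protective: the robber robs a vertex $\nu$ at time $n$ if he is at $\nu$ (uncaught) after round $n$ and does not get caught in round $n+1$. For a (possibly time dependent) strategy $s$ of the cop and a vertex $\nu$, let $$t_r^s(\nu)=\sup\{t\in\mathbb N\mid \text{the robber robs }\nu\text{ at time }t\},\qquad t_c^s(\nu)=\inf\{t\in\mathbb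 N\mid\text{the cop is at }\nu\text{ after round }t\},$$ where the cop plays $s$ and the supremum, respectively infimum, is taken over $t$ and over all possible strategies (ways of playing) of the robber; $\sup\emptyset=-\infty$ and $\inf\emptyset=\infty$. The strategy $s$ is protective if $t_r^s(\nu)<t_c^s(\nu)<\infty$ for every $\nu\in V$. *)

theory Defs
  imports "HOL-Library.Extended_Real"
begin

section \<open>Graphs\<close>

text \<open>
  A graph is a nonempty vertex set \<open>V\<close> (possibly infinite) with a symmetric adjacency relation
  \<open>E\<close> on \<open>V\<close> containing a loop at every vertex. The subgraph induced by a set \<open>S\<close> of vertices
  has the adjacency relation \<open>Restr E S\<close>.
\<close>

definition reflexive_graph :: "'a set \<Rightarrow> 'a rel \<Rightarrow> bool" where
  "reflexive_graph V E \<longleftrightarrow> V \<noteq> {} \<and> E \<subseteq> V \<times> V \<and> refl_on V E \<and> sym E"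

definition locally_finite_graph :: "'a set \<Rightarrow> 'a rel \<Rightarrow> bool" where
  "locally_finite_graph V E \<longleftrightarrow> (\<forall>\<nu>\<in>V. finite {\<gamma>. (\<nu>, \<gamma>) \<in> E})"

definition dominates :: "'a rel \<Rightarrow> 'a \<Rightarrow> 'a \<Rightarrow> bool" where
  "dominates E \<mu> \<nu> \<longleftrightarrow> \<mu> \<noteq> \<nu> \<and> (\<mu>, \<nu>) \<in> E \<and> (\<forall>\<gamma>. (\<nu>, \<gamma>) \<in> E \<longrightarrow> (\<mu>, \<gamma>) \<in> E)"

text \<open>
  Well orders are taken in their reflexive version, so \<open>under r \<nu>\<close> is the set of all
  \<open>\<gamma> \<le> \<nu>\<close>.
\<close>

definition constructible :: "'a set \<Rightarrow> 'a rel \<Rightarrow> bool" where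
  "constructible V E \<longleftrightarrow>
     (\<exists>r. well_order_on V r \<and>
        (\<forall>\<nu>\<in>V. \<not> (\<forall>\<gamma>\<in>V. (\<nu>, \<gamma>) \<in> r) \<longrightarrow>
           (\<exists>\<mu>\<in>under r \<nu>. dominates (Restr E (under r \<nu>)) \<mu> \<nu>)))"


section \<open>The game\<close>

text \<open>
  A strategy of the cop consists of her starting vertex \<open>x\<close> and a map \<open>s\<close>. As the strategy is
  deterministic, a way of playing of the robber is described by the sequence of vertices he
  chooses: \<open>\<rho> k\<close> is his choice in round \<open>2 * k + 1\<close>. Since he may always stay put, every
  finite legal sequence of choices extends to an infinite one, and choices after the end of the
  game are ignored below.
\<close>

definition time_dependent_strategy ::
  "'a set \<Rightarrow> 'a rel \<Rightarrow> 'a \<Rightarrow> ('a \<Rightarrow> 'a \<Rightarrow> nat \<Rightarrow> 'a) \<Rightarrow> bool" where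
  "time_dependent_strategy V E x s \<longleftrightarrow>
     x \<in> V \<and> (\<forall>c\<in>V. \<forall>r\<in>V. \<forall>t. (c, s c r t) \<in> E)"

definition robber_play :: "'a set \<Rightarrow> 'a rel \<Rightarrow> (nat \<Rightarrow> 'a) \<Rightarrow> bool" where
  "robber_play V E \<rho> \<longleftrightarrow> \<rho> 0 \<in> V \<and> (\<forall>k. (\<rho> k, \<rho> (Suc k)) \<in> E)"

text \<open>
  Positions after round \<open>t\<close>. The position of the robber is meaningful for \<open>t \<ge> 1\<close> only,
  and both positions only as long as round \<open>t\<close> is actually played.
\<close>

definition robber_pos :: "(nat \<Rightarrow> 'a) \<Rightarrow> nat \<Rightarrow> 'a" where
  "robber_pos \<rho> t = \<rho> ((t - 1) div 2)"

primrec cop_pos :: "'a \<Rightarrow> ('a \<Rightarrow> 'a \<Rightarrow> nat \<Rightarrow> 'a) \<Rightarrow> (nat \<Rightarrow> 'a) \<Rightarrow> nat \<Rightarrow> 'a" where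
  "cop_pos x s \<rho> 0 = x"
| "cop_pos x s \<rho> (Suc t) =
     (if even (Suc t) then s (cop_pos x s \<rho> t) (robber_pos \<rho> t) (Suc t) else cop_pos x s \<rho> t)"

definition uncaught_after :: "'a \<Rightarrow> ('a \<Rightarrow> 'a \<Rightarrow> nat \<Rightarrow> 'a) \<Rightarrow> (nat \<Rightarrow> 'a) \<Rightarrow> nat \<Rightarrow> bool" where
  "uncaught_after x s \<rho> t \<longleftrightarrow> (\<forall>u\<in>{1..t}. cop_pos x s \<rho> u \<noteq> robber_pos \<rho> u)"

text \<open>
  The game ends when the robber is caught, so round \<open>t > 0\<close> is played if and only if he is
  uncaught after round \<open>t - 1\<close>; round \<open>0\<close> is always played.
\<close>

definition round_played :: "'a \<Rightarrow> ('a \<Rightarrow> 'a \<Rightarrow> nat \<Rightarrow> 'a) \<Rightarrow> (nat \<Rightarrow> 'a) \<Rightarrow> nat \<Rightarrow> bool" where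
  "round_played x s \<rho> t \<longleftrightarrow> uncaught_after x s \<rho> (t - 1)"

definition robs :: "'a \<Rightarrow> ('a \<Rightarrow> 'a \<Rightarrow> nat \<Rightarrow> 'a) \<Rightarrow> (nat \<Rightarrow> 'a) \<Rightarrow> 'a \<Rightarrow> nat \<Rightarrow> bool" where
  "robs x s \<rho> \<nu> n \<longleftrightarrow>
     1 \<le> n \<and> robber_pos \<rho> n = \<nu> \<and> uncaught_after x s \<rho> n \<and> uncaught_after x s \<rho> (Suc n)"


section \<open>Protective strategies\<close>

text \<open>In \<open>ereal\<close>, \<open>Sup {} = -\<infinity>\<close> and \<open>Inf {} = \<infinity>\<close>.\<close>

definition last_rob_time ::
  "'a set \<Rightarrow> 'a rel \<Rightarrow> 'a \<Rightarrow> ('a \<Rightarrow> 'a \<Rightarrow> nat \<Rightarrow> 'a) \<Rightarrow> 'a \<Rightarrow> ereal" where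
  "last_rob_time V E x s \<nu> =
     Sup {ereal (real t) |t \<rho>. robber_play V E \<rho> \<and> robs x s \<rho> \<nu> t}"

definition first_cop_time ::
  "'a set \<Rightarrow> 'a rel \<Rightarrow> 'a \<Rightarrow> ('a \<Rightarrow> 'a \<Rightarrow> nat \<Rightarrow> 'a) \<Rightarrow> 'a \<Rightarrow> ereal" where
  "first_cop_time V E x s \<nu> =
     Inf {ereal (real t) |t \<rho>. robber_play V E \<rho> \<and> round_played x s \<rho> t \<and> cop_pos x s \<rho> t = \<nu>}"

definition protective ::
  "'a set \<Rightarrow> 'a rel \<Rightarrow> 'a \<Rightarrow> ('a \<Rightarrow> 'a \<Rightarrow> nat \<Rightarrow> 'a) \<Rightarrow> bool" where
  "protective V E x s \<longleftrightarrow>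
     (\<forall>\<nu>\<in>V. last_rob_time V E x s \<nu> < first_cop_time V E x s \<nu> \<and> first_cop_time V E x s \<nu> < \<infinity>)"

end

theory Submission
  imports Defs
begin

text \<open>
  Both directions go through a rank function with values in the natural numbers.

  From a protective strategy, rank each vertex \<open>\<nu>\<close> by the first round \<open>t\<close> in which the cop can
  be at \<open>\<nu>\<close>. This \<open>t\<close> is even. Let \<open>\<nu>\<close> be different from her starting vertex. A
  robber who sits at \<open>\<nu>\<close> from the beginning is not caught before round \<open>t\<close>, and he must be caught then, since otherwise he robs \<open>\<nu>\<close> at time \<open>t\<close>. Let \<open>c\<close> be the
  position of the cop just before. The robber could instead have moved to any neighbour \<open>\<gamma>\<close> of \<open>\<nu>\<close>
  in round \<open>t - 1\<close>, to which the cop cannot react before round \<open>t\<close>. If the rank of \<open>\<gamma>\<close> is at most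
  \<open>t\<close>, she has to catch him there as well, so \<open>c\<close> is adjacent to \<open>\<gamma>\<close>. Hence \<open>c\<close>, whose rank is
  smaller than \<open>t\<close>, dominates \<open>\<nu>\<close> among all vertices of rank at most \<open>t\<close>, and every well order
  refining the rank witnesses constructibility (\<open>constructible_if_rank\<close>).

  Conversely, let a locally finite graph be constructible with respect to a well order. Each vertex
  has only finitely many smaller neighbours, so well-founded recursion along smaller neighbours
  yields a rank in the natural numbers that strictly increases from smaller to larger neighbours,
  even if the order type of the given well order is large. Then distinct vertices of equal rank
  are not adjacent, and each vertex \<open>\<nu>\<close> other than the root has a parent of smaller rank that dominates it
  among the vertices of rank at most that of \<open>\<nu>\<close> (\<open>constructible_ranking\<close>). Following parents until
  the rank is at most \<open>n\<close> is a retraction of the graph onto its vertices of rank at most \<open>n\<close>; the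
  image of the robber is his shadow at level \<open>n\<close>. Standing at the shadow at level \<open>n\<close>, the cop can
  always reach the shadow at level \<open>n + 1\<close> of the robber's next position
  (\<open>shadow_next_level\<close>). So she can be at the shadow at level \<open>n\<close> after round
  \<open>2 * n\<close>, for every \<open>n\<close>. In this way a vertex of rank \<open>m\<close> is first visited in round \<open>2 * m\<close>, and
  from this round on every robber on it is caught, because he coincides with his shadow.
\<close>

section \<open>Constructibility from a rank function\<close>

lemma well_order_on_refining_rank:
  fixes T :: "'a \<Rightarrow> nat"
  assumes r0: "well_order_on V r0"
  defines "r \<equiv> {(a, b). a \<in> V \<and> b \<in> V \<and> (T a < T b \<or> T a = T b \<and> (a, b) \<in> r0)}"
  shows "well_order_on V r"
proof -
  have *: "r0 \<subseteq> V \<times> V" "refl_on V r0" "trans r0" "antisym r0" "total_on V r0" "wf (r0 - Id)"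
    using r0 by (auto simp: order_on_defs refl_on_def)
  have "refl_on V r" using *(2) by (auto simp: refl_on_def r_def)
  moreover have "trans r" using *(3) unfolding trans_def r_def by fastforce
  moreover have "antisym r" using *(4) unfolding antisym_def r_def by auto
  moreover have "total_on V r" using *(5) unfolding total_on_def r_def by (auto simp: neq_iff)
  moreover have "r \<subseteq> V \<times> V" by (auto simp: r_def)
  moreover have "wf (r - Id)"
  proof (rule wf_subset)
    show "wf (inv_image (less_than <*lex*> (r0 - Id)) (\<lambda>a. (T a, a)))"
      using *(6) by (intro wf_inv_image wf_lex_prod wf_less_than)
    show "r - Id \<subseteq> inv_image (less_than <*lex*> (r0 - Id)) (\<lambda>a. (T a, a))"
      by (auto simp: r_def)
  qed
  ultimately show ?thesis by (auto simp: order_on_defs)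
qed

text \<open>
  Ties may be broken by any well order, because \<open>\<mu>\<close> dominates \<open>\<nu>\<close> even among all vertices whose
  rank is at most that of \<open>\<nu>\<close>.
\<close>

lemma constructible_if_rank:
  fixes T :: "'a \<Rightarrow> nat"
  assumes "x \<in> V"
    and dom: "\<And>\<nu>. \<nu> \<in> V \<Longrightarrow> \<nu> \<noteq> x \<Longrightarrow>
      \<exists>\<mu>\<in>V. T \<mu> < T \<nu> \<and> (\<mu>, \<nu>) \<in> E \<and> (\<forall>\<gamma>. (\<nu>, \<gamma>) \<in> E \<and> T \<gamma> \<le> T \<nu> \<longrightarrow> (\<mu>, \<gamma>) \<in> E)"
  shows "constructible V E"
proof -
  obtain r0 where r0: "well_order_on V r0" using well_order_on by blast
  then have refl: "refl_on V r0" by (auto simp: order_on_defs)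
  define r where "r = {(a, b). a \<in> V \<and> b \<in> V \<and> (T a < T b \<or> T a = T b \<and> (a, b) \<in> r0)}"
  have wo: "well_order_on V r" unfolding r_def using r0 by (rule well_order_on_refining_rank)
  have "T x < T \<nu>" if "\<nu> \<in> V" "\<nu> \<noteq> x" for \<nu>
    using that by (induction "T \<nu>" arbitrary: \<nu> rule: less_induct) (metis dom order.strict_trans)
  then have least: "(x, \<nu>) \<in> r" if "\<nu> \<in> V" for \<nu>
    using that refl \<open>x \<in> V\<close> by (cases "\<nu> = x") (auto simp: r_def refl_on_def)
  have "\<exists>\<mu>\<in>under r \<nu>. dominates (Restr E (under r \<nu>)) \<mu> \<nu>"
    if "\<nu> \<in> V" "\<not> (\<forall>\<gamma>\<in>V. (\<nu>, \<gamma>) \<in> r)" for \<nu>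
  proof -
    have "\<nu> \<noteq> x" using that least by blast
    then obtain \<mu> where \<mu>: "\<mu> \<in> V" "T \<mu> < T \<nu>" "(\<mu>, \<nu>) \<in> E"
      "\<And>\<gamma>. (\<nu>, \<gamma>) \<in> E \<Longrightarrow> T \<gamma> \<le> T \<nu> \<Longrightarrow> (\<mu>, \<gamma>) \<in> E"
      using dom[OF \<open>\<nu> \<in> V\<close>] by blast
    have "\<mu> \<in> under r \<nu>" "\<nu> \<in> under r \<nu>" "\<And>\<gamma>. \<gamma> \<in> under r \<nu> \<Longrightarrow> T \<gamma> \<le> T \<nu>"
      using \<mu> \<open>\<nu> \<in> V\<close> refl by (auto simp: under_def r_def refl_on_def)
    with \<mu> show ?thesis unfolding dominates_def by (intro bexI[of _ \<mu>]) auto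
  qed
  with wo show ?thesis unfolding constructible_def by blast
qed

section \<open>From a protective strategy to a construction\<close>

lemma uncaught_after_0: "uncaught_after x s \<rho> 0"
  by (simp add: uncaught_after_def)

lemma uncaught_after_Suc:
  "uncaught_after x s \<rho> (Suc t) \<longleftrightarrow>
     uncaught_after x s \<rho> t \<and> cop_pos x s \<rho> (Suc t) \<noteq> robber_pos \<rho> (Suc t)"
  by (auto simp: uncaught_after_def atLeastAtMostSuc_conv)

lemma round_played_0: "round_played x s \<rho> 0"
  by (simp add: round_played_def uncaught_after_0)

lemma round_played_Suc: "round_played x s \<rho> (Suc t) \<longleftrightarrow> uncaught_after x s \<rho> t"
  by (simp add: round_played_def)

lemma round_played_Suc_imp: "round_played x s \<rho> (Suc t) \<Longrightarrow> round_played x s \<rho> t"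
  by (cases t) (auto simp: round_played_0 round_played_Suc uncaught_after_Suc)

lemma cop_pos_cong:
  assumes "\<And>i. 2 * i + 1 < t \<Longrightarrow> \<rho> i = \<rho>' i"
  shows "cop_pos x s \<rho> t = cop_pos x s \<rho>' t"
  using assms
proof (induction t)
  case (Suc t)
  show ?case
  proof (cases "even (Suc t)")
    case True
    then obtain i where "t = 2 * i + 1" by (auto elim: oddE)
    then have "robber_pos \<rho> t = robber_pos \<rho>' t" using Suc.prems[of i] by (simp add: robber_pos_def)
    then show ?thesis using Suc by simp
  qed (use Suc in auto)
qed simp

lemma uncaught_after_cong:
  assumes "\<And>i. 2 * i + 1 \<le> t \<Longrightarrow> \<rho> i = \<rho>' i"
  shows "uncaught_after x s \<rho> t \<longleftrightarrow> uncaught_after x s \<rho>' t"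
proof -
  have "cop_pos x s \<rho> u = cop_pos x s \<rho>' u \<and> robber_pos \<rho> u = robber_pos \<rho>' u"
    if "1 \<le> u" "u \<le> t" for u
    using that by (intro conjI cop_pos_cong, auto simp: robber_pos_def intro!: assms)
  then show ?thesis by (auto simp: uncaught_after_def)
qed

lemma cop_pos_in:
  assumes "reflexive_graph V E" "time_dependent_strategy V E x s" "robber_play V E \<rho>"
  shows "cop_pos x s \<rho> t \<in> V"
proof (induction t)
  case (Suc t)
  have "\<rho> i \<in> V" for i
    using assms(1,3) by (induction i) (auto simp: robber_play_def reflexive_graph_def)
  then have "robber_pos \<rho> t \<in> V" by (simp add: robber_pos_def)
  with Suc have "(cop_pos x s \<rho> t, s (cop_pos x s \<rho> t) (robber_pos \<rho> t) (Suc t)) \<in> E"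
    using assms(2) by (auto simp: time_dependent_strategy_def)
  with Suc assms(1) show ?case by (auto simp: reflexive_graph_def)
qed (use assms(2) in \<open>simp add: time_dependent_strategy_def\<close>)

lemma robber_play_const: "reflexive_graph V E \<Longrightarrow> \<nu> \<in> V \<Longrightarrow> robber_play V E (\<lambda>_. \<nu>)"
  by (auto simp: robber_play_def reflexive_graph_def refl_on_def)

definition cop_can_visit ::
  "'a set \<Rightarrow> 'a rel \<Rightarrow> 'a \<Rightarrow> ('a \<Rightarrow> 'a \<Rightarrow> nat \<Rightarrow> 'a) \<Rightarrow> 'a \<Rightarrow> nat \<Rightarrow> bool" where
  "cop_can_visit V E x s \<nu> t \<longleftrightarrow>
     (\<exists>\<rho>. robber_play V E \<rho> \<and> round_played x s \<rho> t \<and> cop_pos x s \<rho> t = \<nu>)"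

text \<open>
  The extended real infimum is a minimum of natural numbers, which makes it available as a rank.
\<close>

lemma protective_visit_time:
  assumes "protective V E x s" "\<nu> \<in> V"
  shows "\<exists>t. cop_can_visit V E x s \<nu> t"
    and "\<lbrakk>robber_play V E \<rho>; robs x s \<rho> \<nu> n; cop_can_visit V E x s \<nu> t\<rbrakk> \<Longrightarrow> n < t"
proof -
  have first: "first_cop_time V E x s \<nu> = Inf {ereal (real t) |t. cop_can_visit V E x s \<nu> t}"
    unfolding first_cop_time_def cop_can_visit_def by (rule arg_cong[of _ _ Inf]) blast
  have fin: "first_cop_time V E x s \<nu> < \<infinity>"
    and less: "last_rob_time V E x s \<nu> < first_cop_time V E x s \<nu>"
    using assms by (auto simp: protective_def)
  show "\<exists>t. cop_can_visit V E x s \<nu> t"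
  proof (rule ccontr)
    assume "\<nexists>t. cop_can_visit V E x s \<nu> t"
    then have "{ereal (real t) |t. cop_can_visit V E x s \<nu> t} = {}" by blast
    with first fin show False by (simp add: top_ereal_def)
  qed
  assume \<rho>: "robber_play V E \<rho>" "robs x s \<rho> \<nu> n" and t: "cop_can_visit V E x s \<nu> t"
  have "ereal (real n) \<le> last_rob_time V E x s \<nu>"
    unfolding last_rob_time_def by (rule Sup_upper) (use \<rho> in blast)
  also note less
  also have "first_cop_time V E x s \<nu> \<le> ereal (real t)"
    unfolding first by (rule Inf_lower) (use t in blast)
  finally show "n < t" by simp
qed

lemma constructible_if_protective:
  assumes G: "reflexive_graph V E" and s: "time_dependent_strategy V E x s"
    and prot: "protective V E x s"
  shows "constructible V E"
proof -
  define T where "T \<nu> = (LEAST t. cop_can_visit V E x s \<nu> t)" for \<nu>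
  have visit: "cop_can_visit V E x s \<nu> (T \<nu>)" if "\<nu> \<in> V" for \<nu>
    unfolding T_def using protective_visit_time(1)[OF prot that] by (rule LeastI_ex)
  have T_le: "T (cop_pos x s \<rho> t) \<le> t" if "robber_play V E \<rho>" "round_played x s \<rho> t" for \<rho> t
    unfolding T_def by (rule Least_le) (use that in \<open>auto simp: cop_can_visit_def\<close>)
  have robs_less: "n < T \<nu>" if "robber_play V E \<rho>" "robs x s \<rho> \<nu> n" "\<nu> \<in> V" for \<rho> n \<nu>
    using protective_visit_time(2)[OF prot] visit that by blast
  have adj_V: "u \<in> V" "w \<in> V" if "(u, w) \<in> E" for u w
    using G that by (auto simp: reflexive_graph_def)
  have loop: "(v, v) \<in> E" if "v \<in> V" for v
    using G that by (auto simp: reflexive_graph_def refl_on_def)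
  \<comment> \<open>The cop moves in even rounds only, so a visit in an odd round continues an earlier one.\<close>
  have T_even: "\<exists>j. T \<nu> = 2 * j + 2" if "\<nu> \<in> V" "\<nu> \<noteq> x" for \<nu>
  proof -
    obtain \<rho> where \<rho>: "robber_play V E \<rho>" "round_played x s \<rho> (T \<nu>)" "cop_pos x s \<rho> (T \<nu>) = \<nu>"
      using visit[OF \<open>\<nu> \<in> V\<close>] by (auto simp: cop_can_visit_def)
    obtain t where t: "T \<nu> = Suc t"
      using \<rho>(3) \<open>\<nu> \<noteq> x\<close> by (cases "T \<nu>") auto
    have "even (Suc t)"
    proof (rule ccontr)
      assume "odd (Suc t)"
      then have "cop_pos x s \<rho> t = \<nu>" using \<rho>(3) t by simp
      moreover have "round_played x s \<rho> t" using \<rho>(2) t by (auto intro: round_played_Suc_imp)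
      ultimately have "T \<nu> \<le> t" using T_le \<rho>(1) by blast
      with t show False by simp
    qed
    then show ?thesis using t by (auto elim!: oddE)
  qed
  show ?thesis
  proof (rule constructible_if_rank[where x = x and T = T])
    show "x \<in> V" using s by (simp add: time_dependent_strategy_def)
    fix \<nu> assume \<nu>: "\<nu> \<in> V" "\<nu> \<noteq> x"
    obtain j where j: "T \<nu> = 2 * j + 2" using T_even[OF \<nu>] by blast
    let ?stay = "\<lambda>_. \<nu>"
    have stay: "robber_play V E ?stay" using G \<nu>(1) by (rule robber_play_const)
    have uncaught: "uncaught_after x s ?stay t" if "t < T \<nu>" for t
      using that
    proof (induction t)
      case (Suc t)
      then have "uncaught_after x s ?stay t" by simp
      moreover from this have "cop_pos x s ?stay (Suc t) \<noteq> \<nu>"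
        using T_le[OF stay, of "Suc t"] Suc.prems round_played_Suc by (metis not_le)
      ultimately show ?case by (simp add: uncaught_after_Suc robber_pos_def)
    qed (simp add: uncaught_after_0)
    define c where "c = cop_pos x s ?stay (2 * j + 1)"
    have "c \<in> V" unfolding c_def using G s stay by (rule cop_pos_in)
    have "c \<noteq> \<nu>"
      using uncaught[of "2 * j + 1"] j by (simp add: c_def uncaught_after_Suc robber_pos_def)
    have "T c \<le> 2 * j + 1"
      unfolding c_def by (rule T_le[OF stay]) (use uncaught[of "2 * j"] j in \<open>simp add: round_played_Suc\<close>)
    have adj: "(c, \<gamma>) \<in> E" if \<gamma>: "(\<nu>, \<gamma>) \<in> E" "T \<gamma> \<le> T \<nu>" for \<gamma>
    proof (cases "\<gamma> = c")
      case True
      with \<open>c \<in> V\<close> loop show ?thesis by simp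
    next
      case False
      define \<rho> where "\<rho> i = (if i < j then \<nu> else \<gamma>)" for i
      have play: "robber_play V E \<rho>"
        using \<gamma>(1) adj_V loop by (auto simp: robber_play_def \<rho>_def)
      have c: "cop_pos x s \<rho> (2 * j + 1) = c"
        unfolding c_def by (rule cop_pos_cong) (simp add: \<rho>_def)
      have "uncaught_after x s \<rho> (2 * j) \<longleftrightarrow> uncaught_after x s ?stay (2 * j)"
        by (rule uncaught_after_cong) (simp add: \<rho>_def)
      with uncaught j have u1: "uncaught_after x s \<rho> (2 * j)" by simp
      have pos: "robber_pos \<rho> (2 * j + 1) = \<gamma>" "robber_pos \<rho> (2 * j + 2) = \<gamma>"
        "robber_pos \<rho> (2 * j + 3) = \<gamma>" by (auto simp: robber_pos_def \<rho>_def)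
      have u2: "uncaught_after x s \<rho> (2 * j + 1)"
        using u1 c pos False by (simp add: uncaught_after_Suc)
      \<comment> \<open>Otherwise the robber stays at \<open>\<gamma>\<close> for one more round and robs it too late.\<close>
      have "cop_pos x s \<rho> (2 * j + 2) = \<gamma>"
      proof (rule ccontr)
        assume ne: "cop_pos x s \<rho> (2 * j + 2) \<noteq> \<gamma>"
        have u3: "uncaught_after x s \<rho> (2 * j + 2)"
          using u2 ne pos uncaught_after_Suc[of x s \<rho> "2 * j + 1"] by simp
        have "cop_pos x s \<rho> (2 * j + 3) = cop_pos x s \<rho> (2 * j + 2)"
          by (simp add: numeral_3_eq_3)
        then have "uncaught_after x s \<rho> (2 * j + 3)"
          using u3 ne pos uncaught_after_Suc[of x s \<rho> "2 * j + 2"] by (simp add: numeral_3_eq_3)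
        with u3 pos have "robs x s \<rho> \<gamma> (2 * j + 2)" by (simp add: robs_def numeral_3_eq_3)
        then have "2 * j + 2 < T \<gamma>" using robs_less play adj_V(2)[OF \<gamma>(1)] by blast
        with \<gamma>(2) j show False by simp
      qed
      then have "\<gamma> = s c \<gamma> (2 * j + 2)" using c pos by simp
      moreover have "(c, s c \<gamma> (2 * j + 2)) \<in> E"
        using s \<open>c \<in> V\<close> adj_V(2)[OF \<gamma>(1)] by (simp add: time_dependent_strategy_def)
      ultimately show ?thesis by simp
    qed
    show "\<exists>\<mu>\<in>V. T \<mu> < T \<nu> \<and> (\<mu>, \<nu>) \<in> E \<and> (\<forall>\<gamma>. (\<nu>, \<gamma>) \<in> E \<and> T \<gamma> \<le> T \<nu> \<longrightarrow> (\<mu>, \<gamma>) \<in> E)"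
    proof (intro bexI[of _ c] conjI allI impI)
      show "T c < T \<nu>" using \<open>T c \<le> 2 * j + 1\<close> j by simp
      show "(c, \<nu>) \<in> E" using adj[of \<nu>] loop \<nu>(1) by simp
    qed (use adj \<open>c \<in> V\<close> in auto)
  qed
qed

section \<open>Finite ranks in constructible locally finite graphs\<close>

text \<open>
  Taking the sum instead of the supremum keeps the recursion equation short; only monotonicity
  and the value on minimal elements matter.
\<close>

lemma wf_finite_rank:
  assumes "wf R" and "\<And>v. finite {u. (u, v) \<in> R}"
  shows "\<exists>f :: 'a \<Rightarrow> nat. (\<forall>u v. (u, v) \<in> R \<longrightarrow> f u < f v) \<and> (\<forall>v. (\<nexists>u. (u, v) \<in> R) \<longrightarrow> f v = 0)"
proof -
  define f :: "'a \<Rightarrow> nat" where "f = wfrec R (\<lambda>f v. \<Sum>u | (u, v) \<in> R. Suc (f u))"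
  have f: "f v = (\<Sum>u | (u, v) \<in> R. Suc (f u))" for v
    unfolding f_def by (subst wfrec[OF \<open>wf R\<close>]) (auto simp: cut_apply intro!: sum.cong)
  have "f u < f v" if "(u, v) \<in> R" for u v
  proof -
    have "Suc (f u) \<le> (\<Sum>u | (u, v) \<in> R. Suc (f u))"
      using assms(2) that by (intro member_le_sum) auto
    with f[of v] show ?thesis by simp
  qed
  moreover have "f v = 0" if "\<nexists>u. (u, v) \<in> R" for v
    using f[of v] that by simp
  ultimately show ?thesis by blast
qed

locale ranked_graph =
  fixes V :: "'a set" and E :: "'a rel" and root :: 'a and rank :: "'a \<Rightarrow> nat" and parent :: "'a \<Rightarrow> 'a"
  assumes graph: "reflexive_graph V E"
    and root: "root \<in> V" "rank root = 0"
    and rank_adj: "(u, v) \<in> E \<Longrightarrow> u \<noteq> v \<Longrightarrow> rank u \<noteq> rank v"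
    and rank_parent: "v \<in> V \<Longrightarrow> v \<noteq> root \<Longrightarrow> rank (parent v) < rank v"
    and parent_adj: "v \<in> V \<Longrightarrow> v \<noteq> root \<Longrightarrow> (parent v, v) \<in> E"
    and parent_dominates: "v \<noteq> root \<Longrightarrow> (v, u) \<in> E \<Longrightarrow> rank u < rank v \<Longrightarrow> (parent v, u) \<in> E"

text \<open>
  A neighbour of smaller rank is also smaller in the given well order, so the dominating vertex
  supplied by the well order can serve as the parent.
\<close>

lemma constructible_ranking:
  assumes G: "reflexive_graph V E" and lf: "locally_finite_graph V E" and con: "constructible V E"
  shows "\<exists>root rank parent. ranked_graph V E root rank parent"
proof -
  obtain r where r: "well_order_on V r"
    and dom: "\<And>\<nu>. \<nu> \<in> V \<Longrightarrow> \<not> (\<forall>\<gamma>\<in>V. (\<nu>, \<gamma>) \<in> r) \<Longrightarrow>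
      \<exists>\<mu>\<in>under r \<nu>. dominates (Restr E (under r \<nu>)) \<mu> \<nu>"
    using con unfolding constructible_def by blast
  have "refl_on V r" "antisym r" "total_on V r" "wf (r - Id)"
    using r by (auto simp: order_on_defs)
  have E: "E \<subseteq> V \<times> V" "V \<noteq> {}" "sym E" using G by (auto simp: reflexive_graph_def)
  obtain v0 where "v0 \<in> V" using E by blast
  then obtain root where root: "root \<in> V" and minimal: "\<And>y. (y, root) \<in> r - Id \<Longrightarrow> y \<notin> V"
    using wfE_min[OF \<open>wf (r - Id)\<close>] by metis
  then have least: "(root, v) \<in> r" if "v \<in> V" for v
    using that root minimal[of v] \<open>total_on V r\<close> \<open>refl_on V r\<close>
    by (cases "v = root") (auto simp: total_on_def refl_on_def)
  define R where "R = E \<inter> (r - Id)"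
  have "wf R" using \<open>wf (r - Id)\<close> by (rule wf_subset) (auto simp: R_def)
  moreover have "finite {u. (u, v) \<in> R}" for v
  proof (cases "v \<in> V")
    case True
    then have "finite {u. (v, u) \<in> E}" using lf by (simp add: locally_finite_graph_def)
    then show ?thesis by (rule rev_finite_subset) (use \<open>sym E\<close> in \<open>auto simp: R_def sym_def\<close>)
  next
    case False
    then have "{u. (u, v) \<in> R} = {}" using E by (auto simp: R_def)
    then show ?thesis by (simp only: finite.emptyI)
  qed
  ultimately obtain f :: "'a \<Rightarrow> nat"
    where mono: "\<And>u v. (u, v) \<in> R \<Longrightarrow> f u < f v" and zero: "\<And>v. \<nexists>u. (u, v) \<in> R \<Longrightarrow> f v = 0"
    using wf_finite_rank by metis
  have compare: "(u, v) \<in> R \<or> (v, u) \<in> R" if "(u, v) \<in> E" "u \<noteq> v" for u v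
    using that E \<open>total_on V r\<close> by (auto simp: R_def total_on_def dest: symD)
  define parent where "parent v = (SOME \<mu>. \<mu> \<in> under r v \<and> dominates (Restr E (under r v)) \<mu> v)" for v
  have parent: "parent v \<in> under r v \<and> dominates (Restr E (under r v)) (parent v) v"
    if "v \<in> V" "v \<noteq> root" for v
  proof -
    have "\<not> (\<forall>\<gamma>\<in>V. (v, \<gamma>) \<in> r)"
      using that least root \<open>antisym r\<close> by (meson antisymD)
    from dom[OF \<open>v \<in> V\<close> this]
    have "\<exists>\<mu>. \<mu> \<in> under r v \<and> dominates (Restr E (under r v)) \<mu> v" by (simp only: Bex_def)
    then show ?thesis unfolding parent_def by (rule someI_ex)
  qed
  have parent_R: "(parent v, v) \<in> R" if "v \<in> V" "v \<noteq> root" for v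
    using parent[OF that] by (auto simp: R_def under_def dominates_def)
  have "ranked_graph V E root f parent"
  proof
    show "f root = 0"
      using least \<open>antisym r\<close> E by (intro zero) (auto simp: R_def dest: antisymD)
    show "f u \<noteq> f v" if "(u, v) \<in> E" "u \<noteq> v" for u v
      using compare[OF that] mono by fastforce
    show "f (parent v) < f v" if "v \<in> V" "v \<noteq> root" for v
      using parent_R[OF that] by (rule mono)
    show "(parent v, v) \<in> E" if "v \<in> V" "v \<noteq> root" for v
      using parent_R[OF that] by (simp add: R_def)
    show "(parent v, u) \<in> E" if "v \<noteq> root" "(v, u) \<in> E" "f u < f v" for v u
    proof -
      have "v \<in> V" using that E by blast
      have "(u, v) \<in> R" using compare[of v u] mono[of v u] that by auto
      then have "(v, u) \<in> Restr E (under r v)"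
        using that \<open>v \<in> V\<close> \<open>refl_on V r\<close> by (auto simp: R_def under_def refl_on_def)
      with parent[OF \<open>v \<in> V\<close> that(1)] show ?thesis by (auto simp: dominates_def)
    qed
  qed (use G root in auto)
  then show ?thesis by blast
qed

section \<open>Shadows of the robber\<close>

text \<open>
  The test that the parent has smaller rank makes the recursion terminate for arbitrary arguments.
\<close>

function shadow :: "('a \<Rightarrow> nat) \<Rightarrow> ('a \<Rightarrow> 'a) \<Rightarrow> nat \<Rightarrow> 'a \<Rightarrow> 'a" where
  "shadow rank parent n v =
     (if n < rank v \<and> rank (parent v) < rank v then shadow rank parent n (parent v) else v)"
  by pat_completeness auto
termination by (relation "measure (\<lambda>(rank, parent, n, v). rank v)") auto

declare shadow.simps [simp del]

context ranked_graph
begin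

abbreviation shad :: "nat \<Rightarrow> 'a \<Rightarrow> 'a" where
  "shad \<equiv> shadow rank parent"

lemma adj_V: "(u, v) \<in> E \<Longrightarrow> u \<in> V" "(u, v) \<in> E \<Longrightarrow> v \<in> V"
  using graph by (auto simp: reflexive_graph_def)

lemma adj_sym: "(u, v) \<in> E \<Longrightarrow> (v, u) \<in> E"
  using graph by (auto simp: reflexive_graph_def dest: symD)

lemma adj_refl: "v \<in> V \<Longrightarrow> (v, v) \<in> E"
  using graph by (auto simp: reflexive_graph_def refl_on_def)

lemma shad_low: "rank v \<le> n \<Longrightarrow> shad n v = v"
  by (subst shadow.simps) simp

lemma not_root_if_rank: "n < rank v \<Longrightarrow> v \<noteq> root"
  using root by auto

lemma shad_high: "v \<in> V \<Longrightarrow> n < rank v \<Longrightarrow> shad n v = shad n (parent v)"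
  by (subst shadow.simps) (simp add: rank_parent not_root_if_rank)

lemma shad_in_and_rank: "v \<in> V \<Longrightarrow> shad n v \<in> V \<and> rank (shad n v) \<le> n"
proof (induction "rank v" arbitrary: v rule: less_induct)
  case less
  show ?case
  proof (cases "rank v \<le> n")
    case False
    then have "v \<noteq> root" by (intro not_root_if_rank[of n]) simp
    then show ?thesis
      using less False rank_parent parent_adj adj_V(1) by (metis not_le shad_high)
  qed (use less in \<open>simp add: shad_low\<close>)
qed

lemma shad_0: "v \<in> V \<Longrightarrow> shad 0 v = root"
  using shad_in_and_rank[of v 0] rank_parent[of "shad 0 v"] by fastforce

lemma shad_shad_Suc: "v \<in> V \<Longrightarrow> shad n (shad (Suc n) v) = shad n v"
proof (induction "rank v" arbitrary: v rule: less_induct)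
  case less
  show ?case
  proof (cases "rank v \<le> Suc n")
    case False
    then have "v \<noteq> root" by (intro not_root_if_rank[of n]) simp
    then have "shad n (shad (Suc n) (parent v)) = shad n (parent v)"
      using less rank_parent parent_adj adj_V(1) by blast
    with less.prems False show ?thesis by (simp add: shad_high)
  qed (simp add: shad_low)
qed

text \<open>
  Of two distinct neighbours, one has larger rank, and replacing it by its parent keeps them
  adjacent because the parent dominates it.
\<close>

lemma shad_adj: "(u, v) \<in> E \<Longrightarrow> (shad n u, shad n v) \<in> E"
proof (induction "rank u + rank v" arbitrary: u v rule: less_induct)
  case less
  have step: "(shad n u, shad n v) \<in> E"
    if uv: "(u, v) \<in> E" "rank v < rank u" "n < rank u"
      and IH: "(parent u, v) \<in> E \<Longrightarrow> rank (parent u) < rank u \<Longrightarrow>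
        (shad n (parent u), shad n v) \<in> E" for u v
  proof -
    have u: "u \<in> V" "u \<noteq> root" using uv adj_V(1) not_root_if_rank by auto
    then show ?thesis
      using IH uv rank_parent parent_dominates by (simp add: shad_high)
  qed
  consider "u = v" | "rank u \<le> n" "rank v \<le> n" | "rank v < rank u" "n < rank u"
    | "rank u < rank v" "n < rank v"
    using rank_adj[OF less.prems] by linarith
  then show ?case
  proof cases
    case 1
    then show ?thesis using less.prems adj_V shad_in_and_rank adj_refl by blast
  next
    case 2
    then show ?thesis using less.prems by (simp add: shad_low)
  next
    case 3
    show ?thesis
      by (rule step[OF less.prems 3]) (rule less.hyps, auto)
  next
    case 4
    have "(shad n v, shad n u) \<in> E"
      by (rule step[OF adj_sym[OF less.prems] 4]) (rule less.hyps, auto)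
    then show ?thesis by (rule adj_sym)
  qed
qed

text \<open>
  This is the move of the cop. The shadows of \<open>u\<close> and \<open>v\<close> at level \<open>n + 1\<close> are adjacent. If that of
  \<open>u\<close> has rank \<open>n + 1\<close>, then the cop stands on its parent, which dominates it.
\<close>

lemma shadow_next_level:
  assumes "(u, v) \<in> E"
  shows "(shad n u, shad (Suc n) v) \<in> E"
proof -
  define u' v' where "u' = shad (Suc n) u" and "v' = shad (Suc n) v"
  have uv: "(u', v') \<in> E" unfolding u'_def v'_def using assms by (rule shad_adj)
  have V: "u' \<in> V" "rank u' \<le> Suc n" "rank v' \<le> Suc n"
    unfolding u'_def v'_def using shad_in_and_rank adj_V[OF assms] by auto
  have eq: "shad n u = shad n u'" unfolding u'_def using shad_shad_Suc adj_V[OF assms] by simp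
  show ?thesis
  proof (cases "rank u' \<le> n")
    case True
    then show ?thesis using uv eq by (simp add: shad_low v'_def)
  next
    case False
    then have u': "n < rank u'" "u' \<noteq> root" using not_root_if_rank[of n u'] by auto
    then have "shad n u' = parent u'"
      using V rank_parent[of u'] by (simp add: shad_high shad_low)
    moreover have "(parent u', v') \<in> E"
    proof (cases "u' = v'")
      case True
      then show ?thesis using parent_adj V u' by metis
    next
      case False
      then have "rank v' < rank u'" using rank_adj[OF uv] V u' by linarith
      then show ?thesis using parent_dominates uv u' by blast
    qed
    ultimately show ?thesis using eq by (simp add: v'_def)
  qed
qed

section \<open>The shadow strategy\<close>

text \<open>
  The level of the shadow to be reached is read off from the number of the round. The cop stays put
  on configurations that do not occur.
\<close>

definition strategy :: "'a \<Rightarrow> 'a \<Rightarrow> nat \<Rightarrow> 'a" where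
  "strategy c r t = (let c' = shad (t div 2) r in if (c, c') \<in> E then c' else c)"

lemma strategy_valid: "time_dependent_strategy V E root strategy"
  using root adj_refl by (auto simp: time_dependent_strategy_def strategy_def Let_def)

text \<open>
  In rounds \<open>0\<close> and \<open>1\<close> truncated subtraction yields the robber's initial vertex, whose shadow at
  level \<open>0\<close> is the root, like every other shadow at that level.
\<close>

lemma cop_pos_strategy:
  assumes play: "robber_play V E \<rho>"
  shows "cop_pos root strategy \<rho> t = shad (t div 2) (\<rho> (t div 2 - 1))"
proof (induction t)
  case 0
  show ?case using play by (simp add: shad_0 robber_play_def)
next
  case (Suc t)
  show ?case
  proof (cases "even (Suc t)")
    case True
    then obtain k where t: "t = 2 * k + 1" by (auto elim: oddE)
    have "(\<rho> (k - 1), \<rho> k) \<in> E"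
      using play adj_refl by (cases k) (auto simp: robber_play_def)
    then have "(shad k (\<rho> (k - 1)), shad (Suc k) (\<rho> k)) \<in> E" by (rule shadow_next_level)
    with Suc t show ?thesis by (simp add: strategy_def robber_pos_def)
  next
    case False
    then have "Suc t div 2 = t div 2" by presburger
    with Suc False show ?thesis by simp
  qed
qed

lemma play_in: "robber_play V E \<rho> \<Longrightarrow> \<rho> i \<in> V"
  by (induction i) (auto simp: robber_play_def intro: adj_V(2))

lemma rank_cop_pos: "robber_play V E \<rho> \<Longrightarrow> rank (cop_pos root strategy \<rho> t) \<le> t div 2"
  using shad_in_and_rank play_in by (simp add: cop_pos_strategy)

lemma uncaught_rank:
  assumes "robber_play V E \<rho>" and "uncaught_after root strategy \<rho> (2 * k + 2)"
  shows "k + 1 < rank (\<rho> k)"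
proof (rule ccontr)
  assume "\<not> ?thesis"
  then have "cop_pos root strategy \<rho> (2 * k + 2) = robber_pos \<rho> (2 * k + 2)"
    using cop_pos_strategy[OF assms(1), of "2 * k + 2"] by (simp add: shad_low robber_pos_def)
  with assms(2) show False unfolding uncaught_after_def
    by (metis atLeastAtMost_iff le_add2 one_le_numeral order_trans order_refl)
qed

lemma robs_less_rank:
  assumes play: "robber_play V E \<rho>" and robs: "robs root strategy \<rho> \<nu> n"
  shows "n < 2 * rank \<nu>"
proof (cases "even n")
  case True
  with robs obtain k where n: "n = 2 * k + 2"
    by (cases n) (auto simp: robs_def elim!: oddE)
  then show ?thesis
    using uncaught_rank[OF play, of k] robs by (simp add: robs_def robber_pos_def)
next
  case False
  then obtain k where n: "n = 2 * k + 1" by (auto elim: oddE)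
  then show ?thesis
    using uncaught_rank[OF play, of k] robs by (simp add: robs_def robber_pos_def)
qed

lemma strategy_protective: "protective V E root strategy"
  unfolding protective_def
proof (intro ballI conjI)
  fix \<nu> assume \<nu>: "\<nu> \<in> V"
  let ?m = "rank \<nu>"
  have "last_rob_time V E root strategy \<nu> \<le> ereal (2 * real ?m - 1)"
    unfolding last_rob_time_def
  proof (rule Sup_least, clarify)
    fix t \<rho> assume "robber_play V E \<rho>" "robs root strategy \<rho> \<nu> t"
    then have "t + 1 \<le> 2 * ?m" using robs_less_rank by fastforce
    then have "real t + 1 \<le> 2 * real ?m" by linarith
    then show "ereal (real t) \<le> ereal (2 * real ?m - 1)" by simp
  qed
  also have "\<dots> < ereal (2 * real ?m)" by simp
  also have "\<dots> \<le> first_cop_time V E root strategy \<nu>"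
    unfolding first_cop_time_def
  proof (rule Inf_greatest, clarify)
    fix t \<rho> assume "robber_play V E \<rho>" "\<nu> = cop_pos root strategy \<rho> t"
    then have "2 * ?m \<le> t" using rank_cop_pos[of \<rho> t] by simp
    then show "ereal (2 * real (rank (cop_pos root strategy \<rho> t))) \<le> ereal (real t)"
      using \<open>\<nu> = _\<close> by simp
  qed
  finally show "last_rob_time V E root strategy \<nu> < first_cop_time V E root strategy \<nu>" .
  have stay: "robber_play V E (\<lambda>_. \<nu>)" using graph \<nu> by (rule robber_play_const)
  \<comment> \<open>A robber who stays at \<open>\<nu>\<close> draws the cop there, since she only visits vertices of smaller rank
    in earlier rounds.\<close>
  have "rank (cop_pos root strategy (\<lambda>_. \<nu>) u) < ?m" if "u \<in> {1..2 * ?m - 1}" for u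
    using rank_cop_pos[OF stay, of u] that by auto
  then have "round_played root strategy (\<lambda>_. \<nu>) (2 * ?m)"
    by (fastforce simp: round_played_def uncaught_after_def robber_pos_def)
  moreover have "cop_pos root strategy (\<lambda>_. \<nu>) (2 * ?m) = \<nu>"
    using cop_pos_strategy[OF stay] by (simp add: shad_low)
  ultimately have "first_cop_time V E root strategy \<nu> \<le> ereal (real (2 * ?m))"
    unfolding first_cop_time_def using stay by (intro Inf_lower) blast
  also have "\<dots> < \<infinity>" by simp
  finally show "first_cop_time V E root strategy \<nu> < \<infinity>" .
qed

end

theorem theorem13:
  fixes V :: "'a set" and E :: "'a rel"
  assumes "reflexive_graph V E" and "locally_finite_graph V E"
  shows "constructible V E \<longleftrightarrow>
    (\<exists>x s. time_dependent_strategy V E x s \<and> protective V E x s)"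
proof
  assume "constructible V E"
  then obtain root rank parent where "ranked_graph V E root rank parent"
    using constructible_ranking assms by blast
  then interpret ranked_graph V E root rank parent .
  show "\<exists>x s. time_dependent_strategy V E x s \<and> protective V E x s"
    using strategy_valid strategy_protective by blast
next
  assume "\<exists>x s. time_dependent_strategy V E x s \<and> protective V E x s"
  then show "constructible V E"
    by (elim exE conjE) (rule constructible_if_protective[OF assms(1)])
qed

end
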